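(* Let $E$ be the class of all functions $f \in \mathcal{A}(D)$ such that the $2\pi$-periodic function $u:\mathbb{R}\to\mathbb{R}$, $u(\theta)=\operatorname{Re} f(e^{i\theta})$, is not differentiable at any point $\theta \in \mathbb{R}$. Then $E$ is residual in $\mathcal{A}(D)$, i.e. $E$ contains a subset of $\mathcal{A}(D)$ which is $G_\delta$ and dense in $\mathcal{A}(D)$.
   Context: $D$ is the open unit disc in $\mathbb{C}$. The disc algebra $\mathcal{A}(D)$ is the set of all holomorphic functions on $D$ which extend continuously to $\overline{D}$, endowed with the supremum norm on $\overline{D}$ (with which it is a complex Banach algebra); each $f\in\mathcal{A}(D)$ is identified with its continuous extension to $\overline{D}$. Differentiability means existence of a finite derivative. *)

theory Defs
  imports "HOL-Analysis.Analysis"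
begin

(* An element is represented by its continuous extension to the closed disc, made
   extensional (undefined outside the closed disc) so that it is determined by its
   values there.  The distance inherited from cfunspace is that of the supremum norm. *)
definition disc_algebra :: "(complex \<Rightarrow> complex) metric" where
  "disc_algebra =
     submetric (cfunspace (top_of_set (cball 0 1)) euclidean_metric)
       {f. f holomorphic_on ball 0 1}"

definition residual_in :: "'a topology \<Rightarrow> 'a set \<Rightarrow> bool" where
  "residual_in X E \<longleftrightarrow> (\<exists>G. gdelta_in X G \<and> X closure_of G = topspace X \<and> G \<subseteq> E)"

lemma mspace_disc_algebra:
  "mspace disc_algebra =
     {f \<in> extensional (cball 0 1). continuous_on (cball 0 1) f \<and> f holomorphic_on ball 0 1}"
proof -
  have "bounded (f ` cball 0 1)" if "continuous_on (cball 0 1) f"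
    for f :: "complex \<Rightarrow> complex"
    using that by (intro compact_imp_bounded compact_continuous_image compact_cball)
  then show ?thesis
    by (auto simp: disc_algebra_def)
qed

lemma mdist_disc_algebra:
  assumes "f \<in> mspace disc_algebra" "g \<in> mspace disc_algebra"
  shows "mdist disc_algebra f g = (SUP z\<in>cball 0 1. norm (f z - g z))"
proof -
  have "f \<in> mspace (funspace (cball 0 1) euclidean_metric)"
       "g \<in> mspace (funspace (cball 0 1) euclidean_metric)"
    using assms cfunspace_subset_funspace[of "top_of_set (cball 0 1)" euclidean_metric]
    by (auto simp: disc_algebra_def)
  then show ?thesis
    by (simp add: disc_algebra_def mdist_cfunspace_eq_mdist_funspace Met_TC.fdist_def dist_norm)
qed

(* Justifies identifying a holomorphic function on the open disc that extends
   continuously to the closed disc with its extension. *)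
lemma disc_algebra_unique_extension:
  assumes "h holomorphic_on ball 0 1"
    and "continuous_on (cball 0 1) g" and "\<And>z. z \<in> ball 0 1 \<Longrightarrow> g z = h z"
  shows "\<exists>!f. f \<in> mspace disc_algebra \<and> (\<forall>z\<in>ball 0 1. f z = h z)"
proof (rule ex1I)
  let ?f = "restrict g (cball 0 1)"
  have "?f holomorphic_on ball 0 1"
    using assms(1) by (rule holomorphic_transform) (use assms(3) in auto)
  moreover have "continuous_on (cball 0 1) ?f"
    using assms(2) by (subst continuous_on_cong[OF refl, of _ _ g]) auto
  ultimately show "?f \<in> mspace disc_algebra \<and> (\<forall>z\<in>ball 0 1. ?f z = h z)"
    using assms(3) by (simp add: mspace_disc_algebra)
next
  fix f assume f: "f \<in> mspace disc_algebra \<and> (\<forall>z\<in>ball 0 1. f z = h z)"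
  have "f z - g z = 0" if "z \<in> cball 0 1" for z
  proof (rule continuous_constant_on_closure[of "ball 0 1" "\<lambda>z. f z - g z"])
    show "continuous_on (closure (ball 0 1)) (\<lambda>z. f z - g z)"
      using f assms(2) by (auto simp: mspace_disc_algebra intro: continuous_on_diff)
  qed (use f assms(3) that in auto)
  then show "f = restrict g (cball 0 1)"
    using f by (intro extensionalityI[of _ "cball 0 1"]) (auto simp: mspace_disc_algebra)
qed

end

(* If u is differentiable at some \<theta>, then, u being bounded, |u t - u \<theta>| \<le> n |t - \<theta>| for
   some n and all t.  For fixed n, the functions admitting such a \<theta> form a closed set, by
   compactness of a period.  Its complement is dense: approximate f by the dilation f(sz),
   whose boundary values are Lipschitz, and add e z^N; the added real part e cos(N\<theta>) varies
   by at least e within distance pi/(2N) of every \<theta>, which beats any fixed Lipschitz constant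
   once N is large.  Baire's theorem in the complete space A(D) concludes. *)

theory Submission
  imports Defs "HOL-Complex_Analysis.Cauchy_Integral_Formula"
begin

section \<open>The supremum metric and completeness of the disc algebra\<close>

lemma norm_diff_le_mdist_disc_algebra:
  assumes "f \<in> mspace disc_algebra" "g \<in> mspace disc_algebra" "z \<in> cball 0 1"
  shows "norm (f z - g z) \<le> mdist disc_algebra f g"
proof -
  have "compact ((\<lambda>z. norm (f z - g z)) ` cball 0 1)"
    using assms(1,2)
    by (intro compact_continuous_image continuous_intros)
       (auto simp: mspace_disc_algebra intro!: continuous_intros)
  then have "bdd_above ((\<lambda>z. norm (f z - g z)) ` cball 0 1)"
    by (intro bounded_imp_bdd_above compact_imp_bounded)
  then show ?thesis
    unfolding mdist_disc_algebra[OF assms(1,2)] using assms(3) by (intro cSUP_upper)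
qed

lemma mdist_disc_algebra_le:
  assumes "f \<in> mspace disc_algebra" "g \<in> mspace disc_algebra"
    and "\<And>z. z \<in> cball 0 1 \<Longrightarrow> norm (f z - g z) \<le> e"
  shows "mdist disc_algebra f g \<le> e"
  unfolding mdist_disc_algebra[OF assms(1,2)] using assms(3) by (intro cSUP_least) auto

lemma restrict_in_disc_algebra:
  assumes "continuous_on (cball 0 1) f" "f holomorphic_on ball 0 1"
  shows "restrict f (cball 0 1) \<in> mspace disc_algebra"
proof -
  have "restrict f (cball 0 1) holomorphic_on ball 0 1"
    using assms(2) by (rule holomorphic_transform) auto
  moreover have "continuous_on (cball 0 1) (restrict f (cball 0 1))"
    using assms(1) by (subst continuous_on_cong[OF refl, of _ _ f]) auto
  ultimately show ?thesis
    by (simp add: mspace_disc_algebra)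
qed

interpretation disc: Metric_space "mspace disc_algebra" "mdist disc_algebra"
  by (rule Metric_space_mspace_mdist)

text \<open>Cauchy in the supremum metric means uniformly Cauchy on the closed disc, and a uniform
  limit there inherits both continuity on the closed disc and holomorphy inside. The pointwise limit
  \<open>g\<close> is arbitrary outside the disc, so the limit in the space is its
  restriction.\<close>

lemma mcomplete_disc_algebra: "disc.mcomplete"
  unfolding disc.mcomplete_def
proof (intro strip)
  fix \<sigma> assume \<sigma>: "disc.MCauchy \<sigma>"
  then have in_M: "\<sigma> n \<in> mspace disc_algebra" for n
    by (auto simp: disc.MCauchy_def)
  have "uniformly_Cauchy_on (cball 0 1) \<sigma>"
    unfolding uniformly_Cauchy_on_def
  proof (intro strip)
    fix e :: real assume "e > 0"
    then obtain N where N: "\<And>m n. N \<le> m \<Longrightarrow> N \<le> n \<Longrightarrow> mdist disc_algebra (\<sigma> m) (\<sigma> n) < e"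
      using \<sigma> unfolding disc.MCauchy_def by blast
    show "\<exists>M. \<forall>z\<in>cball 0 1. \<forall>m\<ge>M. \<forall>n\<ge>M. dist (\<sigma> m z) (\<sigma> n z) < e"
      using N norm_diff_le_mdist_disc_algebra[OF in_M in_M]
      unfolding dist_norm by (meson le_less_trans)
  qed
  then obtain g where g: "uniform_limit (cball 0 1) \<sigma> g sequentially"
    by (blast dest: Cauchy_uniformly_convergent[unfolded uniformly_convergent_on_def])
  obtain "continuous_on (cball 0 1) g" "g holomorphic_on ball 0 1"
    by (rule holomorphic_uniform_limit[OF _ g]) (use in_M in \<open>auto simp: mspace_disc_algebra\<close>)
  then have gM: "restrict g (cball 0 1) \<in> mspace disc_algebra"
    by (rule restrict_in_disc_algebra)
  have "limitin disc.mtopology \<sigma> (restrict g (cball 0 1)) sequentially"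
    unfolding disc.limitin_metric
  proof (intro conjI strip gM)
    fix e :: real assume "e > 0"
    \<comment> \<open>Strict pointwise bounds give only a weak bound on the supremum;
      \<open>e/2\<close> leaves room for the strict inequality below \<open>e\<close>.\<close>
    then have "\<forall>\<^sub>F n in sequentially. \<forall>z\<in>cball 0 1. dist (\<sigma> n z) (g z) < e/2"
      using g by (intro uniform_limitD) auto
    then show "\<forall>\<^sub>F n in sequentially. \<sigma> n \<in> mspace disc_algebra \<and>
        mdist disc_algebra (\<sigma> n) (restrict g (cball 0 1)) < e"
    proof eventually_elim
      case (elim n)
      have "mdist disc_algebra (\<sigma> n) (restrict g (cball 0 1)) \<le> e/2"
        using elim by (intro mdist_disc_algebra_le in_M gM) (auto simp: dist_norm less_imp_le)
      then show ?case
        using in_M \<open>e > 0\<close> by auto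
    qed
  qed
  then show "\<exists>x. limitin disc.mtopology \<sigma> x sequentially"
    by blast
qed

section \<open>Real parts of boundary values, and differentiability at a point\<close>

abbreviation (input) boundary_re :: "(complex \<Rightarrow> complex) \<Rightarrow> real \<Rightarrow> real" where
  "boundary_re f t \<equiv> Re (f (exp (\<i> * of_real t)))"

lemma continuous_on_boundary_re:
  assumes "f \<in> mspace disc_algebra"
  shows "continuous_on UNIV (boundary_re f)"
proof -
  have "continuous_on (cball 0 1) f"
    using assms by (simp add: mspace_disc_algebra)
  moreover have "continuous_on UNIV (\<lambda>t::real. exp (\<i> * of_real t))"
    by (intro continuous_intros)
  moreover have "range (\<lambda>t::real. exp (\<i> * of_real t)) \<subseteq> cball 0 1"
    by auto
  ultimately show ?thesis
    by (intro continuous_on_Re) (rule continuous_on_compose2)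
qed

lemma bounded_boundary_re:
  assumes "f \<in> mspace disc_algebra"
  obtains B where "\<And>t. \<bar>boundary_re f t\<bar> \<le> B"
proof -
  have "bounded (f ` cball 0 1)"
    using assms
    by (intro compact_imp_bounded compact_continuous_image compact_cball)
       (simp add: mspace_disc_algebra)
  then obtain B where B: "\<And>z. z \<in> cball 0 1 \<Longrightarrow> norm (f z) \<le> B"
    unfolding bounded_iff by blast
  have "\<bar>boundary_re f t\<bar> \<le> B" for t
    using abs_Re_le_cmod[of "f (exp (\<i> * of_real t))"] B[of "exp (\<i> * of_real t)"] by simp
  then show ?thesis
    using that by blast
qed

text \<open>Within distance \<open>d\<close> of \<open>x\<close> the difference quotient differs
  from the derivative \<open>D\<close> by less than 1. Farther away its numerator is at most
  \<open>2 * B\<close> and its denominator at least \<open>d\<close>. The constant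
  \<open>\<bar>D\<bar> + 1 + 2 * B / d\<close> covers both cases. Having the estimate for all
  \<open>t\<close>, with no radius depending on the function, is what lets it pass to
  limits.\<close>

lemma differentiable_bounded_imp_Lipschitz_at:
  fixes u :: "real \<Rightarrow> real"
  assumes "u differentiable (at x)" and B: "\<And>t. \<bar>u t\<bar> \<le> B"
  shows "\<exists>C. \<forall>t. \<bar>u t - u x\<bar> \<le> C * \<bar>t - x\<bar>"
proof -
  obtain D where "(u has_real_derivative D) (at x)"
    using assms(1) real_differentiable_def by blast
  then have "((\<lambda>t. (u t - u x) / (t - x)) \<longlongrightarrow> D) (at x)"
    by (simp add: has_field_derivative_iff)
  then have "\<forall>\<^sub>F t in at x. dist ((u t - u x) / (t - x)) D < 1"
    by (rule tendstoD) simp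
  then obtain d where d: "d > 0"
    "\<And>t. t \<noteq> x \<Longrightarrow> dist t x < d \<Longrightarrow> dist ((u t - u x) / (t - x)) D < 1"
    by (auto simp: eventually_at)
  have "B \<ge> 0"
    using B[of x] by linarith
  have "\<bar>u t - u x\<bar> \<le> (\<bar>D\<bar> + 1 + 2 * B / d) * \<bar>t - x\<bar>" for t
  proof (cases "t = x")
    case False
    have "\<bar>(u t - u x) / (t - x)\<bar> \<le> \<bar>D\<bar> + 1 + 2 * B / d"
    proof (cases "dist t x < d")
      case True
      moreover have "2 * B / d \<ge> 0"
        using \<open>B \<ge> 0\<close> d(1) by simp
      ultimately show ?thesis
        using d(2)[OF False True] unfolding dist_real_def by linarith
    next
      case far: False
      have "\<bar>(u t - u x) / (t - x)\<bar> \<le> 2 * B / d"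
        unfolding abs_divide
        using far d(1) B[of t] B[of x] by (intro frac_le) (auto simp: dist_real_def)
      then show ?thesis
        by linarith
    qed
    then show ?thesis
      using False by (simp add: abs_divide divide_simps)
  qed simp
  then show ?thesis
    by blast
qed

section \<open>The sets \<open>Lipschitz_somewhere c\<close> are closed\<close>

definition Lipschitz_somewhere :: "real \<Rightarrow> (complex \<Rightarrow> complex) set" where
  "Lipschitz_somewhere c = {f \<in> mspace disc_algebra.
     \<exists>\<theta>. \<forall>t. \<bar>boundary_re f t - boundary_re f \<theta>\<bar> \<le> c * \<bar>t - \<theta>\<bar>}"

lemma boundary_re_periodic: "boundary_re f (t + 2 * pi * of_int k) = boundary_re f t"
proof -
  have "exp (\<i> * of_real (t + 2 * pi * of_int k)) = exp (\<i> * of_real t)"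
    unfolding exp_eq by (rule exI[of _ k]) (simp add: algebra_simps)
  then show ?thesis
    by simp
qed

text \<open>The exceptional point is confined to a compact interval, so that a subsequence of such
  points can be extracted. Since \<open>t\<close> runs over all reals, shifting \<open>t\<close> and
  \<open>\<theta>\<close> together by a multiple of the period keeps the same constant
  \<open>c\<close>.\<close>

lemma Lipschitz_somewhere_in_period:
  assumes "f \<in> Lipschitz_somewhere c"
  obtains \<theta> where "\<theta> \<in> {0..2 * pi}"
    "\<And>t. \<bar>boundary_re f t - boundary_re f \<theta>\<bar> \<le> c * \<bar>t - \<theta>\<bar>"
proof -
  obtain \<theta> where \<theta>: "\<And>t. \<bar>boundary_re f t - boundary_re f \<theta>\<bar> \<le> c * \<bar>t - \<theta>\<bar>"
    using assms by (auto simp: Lipschitz_somewhere_def)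
  define k where "k = \<lfloor>\<theta> / (2 * pi)\<rfloor>"
  have "of_int k \<le> \<theta> / (2 * pi)" "\<theta> / (2 * pi) < of_int k + 1"
    unfolding k_def by linarith+
  then have "\<theta> - 2 * pi * of_int k \<in> {0..2 * pi}"
    by (simp add: field_simps)
  moreover have "\<bar>boundary_re f t - boundary_re f (\<theta> - 2 * pi * of_int k)\<bar>
      \<le> c * \<bar>t - (\<theta> - 2 * pi * of_int k)\<bar>" for t
    using \<theta>[of "t + 2 * pi * of_int k"] boundary_re_periodic[of f t k]
      boundary_re_periodic[of f "\<theta> - 2 * pi * of_int k" k]
    by (simp add: algebra_simps)
  ultimately show ?thesis
    by (rule that)
qed

text \<open>Each member of a convergent sequence has its own exceptional point in one period. Along
  a subsequence these points converge to some \<open>\<theta>'\<close>, and the estimate survives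
  the limit with the same \<open>c\<close>, making \<open>\<theta>'\<close> an exceptional point of
  \<open>l\<close>.\<close>

lemma closedin_Lipschitz_somewhere: "closedin disc.mtopology (Lipschitz_somewhere c)"
  unfolding disc.metric_closedin_iff_sequentially_closed
proof (intro conjI strip)
  show "Lipschitz_somewhere c \<subseteq> mspace disc_algebra"
    by (auto simp: Lipschitz_somewhere_def)
  fix \<sigma> l
  assume asm: "range \<sigma> \<subseteq> Lipschitz_somewhere c \<and> limitin disc.mtopology \<sigma> l sequentially"
  then have \<sigma>L: "\<sigma> k \<in> Lipschitz_somewhere c" for k
    by blast
  then have \<sigma>M: "\<sigma> k \<in> mspace disc_algebra" for k
    unfolding Lipschitz_somewhere_def by blast
  have lM: "l \<in> mspace disc_algebra" and lim: "(\<lambda>k. mdist disc_algebra (\<sigma> k) l) \<longlonglongrightarrow> 0"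
    using asm by (auto simp: disc.limitin_metric_dist_null)
  have "\<exists>\<theta>\<in>{0..2 * pi}. \<forall>t. \<bar>boundary_re (\<sigma> k) t - boundary_re (\<sigma> k) \<theta>\<bar> \<le> c * \<bar>t - \<theta>\<bar>" for k
    using Lipschitz_somewhere_in_period[OF \<sigma>L[of k]] by blast
  then obtain \<theta> where \<theta>: "\<And>k. \<theta> k \<in> {0..2 * pi}"
    "\<And>k t. \<bar>boundary_re (\<sigma> k) t - boundary_re (\<sigma> k) (\<theta> k)\<bar> \<le> c * \<bar>t - \<theta> k\<bar>"
    by metis
  obtain \<theta>' r where r: "strict_mono r" "(\<theta> \<circ> r) \<longlonglongrightarrow> \<theta>'"
    using compact_Icc[of 0 "2 * pi"] \<theta>(1) unfolding compact_def by (metis (no_types))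
  have close: "\<bar>boundary_re (\<sigma> k) t - boundary_re l t\<bar> \<le> mdist disc_algebra (\<sigma> k) l" for k t
  proof -
    have "\<bar>boundary_re (\<sigma> k) t - boundary_re l t\<bar>
        \<le> norm (\<sigma> k (exp (\<i> * of_real t)) - l (exp (\<i> * of_real t)))"
      by (metis abs_Re_le_cmod minus_complex.sel(1))
    also have "\<dots> \<le> mdist disc_algebra (\<sigma> k) l"
      by (intro norm_diff_le_mdist_disc_algebra \<sigma>M lM) simp
    finally show ?thesis .
  qed
  have "\<bar>boundary_re l t - boundary_re l \<theta>'\<bar> \<le> c * \<bar>t - \<theta>'\<bar>" for t
  proof (rule LIMSEQ_le)
    \<comment> \<open>The function is fixed as \<open>l\<close> while the points move, so continuity
      of \<open>l\<close> alone handles the left side; the cost of replacing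
      \<open>\<sigma> (r k)\<close> by \<open>l\<close> goes to the right side.\<close>
    have "isCont (boundary_re l) \<theta>'"
      using continuous_on_boundary_re[OF lM] by (simp add: continuous_on_eq_continuous_at)
    then have "(\<lambda>k. boundary_re l ((\<theta> \<circ> r) k)) \<longlonglongrightarrow> boundary_re l \<theta>'"
      by (rule isCont_tendsto_compose[OF _ r(2)])
    then show "(\<lambda>k. \<bar>boundary_re l t - boundary_re l ((\<theta> \<circ> r) k)\<bar>)
        \<longlonglongrightarrow> \<bar>boundary_re l t - boundary_re l \<theta>'\<bar>"
      by (intro tendsto_rabs tendsto_diff tendsto_const)
    \<comment> \<open>The factor 2 arises because \<open>\<sigma> (r k)\<close> is replaced by
      \<open>l\<close> at two points, \<open>t\<close> and \<open>\<theta> (r k)\<close>.\<close>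
    have "(\<lambda>k. c * \<bar>t - (\<theta> \<circ> r) k\<bar> + 2 * ((\<lambda>k. mdist disc_algebra (\<sigma> k) l) \<circ> r) k)
        \<longlonglongrightarrow> c * \<bar>t - \<theta>'\<bar> + 2 * 0"
      by (intro tendsto_add tendsto_mult tendsto_rabs tendsto_diff tendsto_const r(2)
            LIMSEQ_subseq_LIMSEQ[OF lim r(1)])
    then show "(\<lambda>k. c * \<bar>t - (\<theta> \<circ> r) k\<bar> + 2 * mdist disc_algebra (\<sigma> (r k)) l)
        \<longlonglongrightarrow> c * \<bar>t - \<theta>'\<bar>"
      by simp
    show "\<exists>N. \<forall>k\<ge>N. \<bar>boundary_re l t - boundary_re l ((\<theta> \<circ> r) k)\<bar>
        \<le> c * \<bar>t - (\<theta> \<circ> r) k\<bar> + 2 * mdist disc_algebra (\<sigma> (r k)) l"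
    proof (intro exI strip)
      fix k
      show "\<bar>boundary_re l t - boundary_re l ((\<theta> \<circ> r) k)\<bar>
        \<le> c * \<bar>t - (\<theta> \<circ> r) k\<bar> + 2 * mdist disc_algebra (\<sigma> (r k)) l"
        using \<theta>(2)[of "r k" t] close[of "r k" t] close[of "r k" "\<theta> (r k)"]
        unfolding o_def by linarith
    qed
  qed
  then show "l \<in> Lipschitz_somewhere c"
    using lM by (auto simp: Lipschitz_somewhere_def)
qed

section \<open>Density of the complements: dilation and rapid oscillation\<close>

lemma norm_exp_i_diff_le: "norm (exp (\<i> * of_real s) - exp (\<i> * of_real t)) \<le> \<bar>s - t\<bar>" for s t :: real
proof -
  have "exp (\<i> * of_real s) - exp (\<i> * of_real t)
      = exp (\<i> * of_real t) * (exp (\<i> * of_real (s - t)) - 1)"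
    by (simp add: algebra_simps flip: exp_add)
  then have "norm (exp (\<i> * of_real s) - exp (\<i> * of_real t)) = 2 * \<bar>sin ((s - t) / 2)\<bar>"
    by (simp only: norm_mult norm_exp_i_times dist_exp_i_1 mult_1)
  also have "\<dots> \<le> 2 * \<bar>(s - t) / 2\<bar>"
    using abs_sin_x_le_abs_x[of "(s - t) / 2"] by linarith
  finally show ?thesis
    by simp
qed

text \<open>The shifts by \<open>pi / 2\<close> and \<open>- (pi / 2)\<close> change the cosine by
  \<open>- sin x - cos x\<close> and \<open>sin x - cos x\<close>. The larger of the two absolute
  values is \<open>\<bar>sin x\<bar> + \<bar>cos x\<bar>\<close>, which is at least
  \<open>(sin x)\<^sup>2 + (cos x)\<^sup>2 = 1\<close>. The signs of sine and cosine decide which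
  shift works.\<close>

lemma cos_quarter_period_shift:
  fixes x :: real
  obtains h where "\<bar>h\<bar> = pi / 2" "\<bar>cos (x + h) - cos x\<bar> \<ge> 1"
proof -
  have "(sin x)\<^sup>2 \<le> \<bar>sin x\<bar>" "(cos x)\<^sup>2 \<le> \<bar>cos x\<bar>"
    using mult_left_le[of "\<bar>sin x\<bar>" "\<bar>sin x\<bar>"] mult_left_le[of "\<bar>cos x\<bar>" "\<bar>cos x\<bar>"]
    by (auto simp: power2_eq_square abs_mult_self_eq)
  then have "\<bar>sin x\<bar> + \<bar>cos x\<bar> \<ge> 1"
    using sin_cos_squared_add[of x] by linarith
  then have "\<bar>- sin x - cos x\<bar> \<ge> 1 \<or> \<bar>sin x - cos x\<bar> \<ge> 1"
    by linarith
  then show ?thesis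
    using that[of "pi / 2"] that[of "- (pi / 2)"] by (auto simp: cos_add cos_diff)
qed

text \<open>The derivative of \<open>f\<close> may blow up at the unit circle, but the dilation only
  sees \<open>f\<close> on the compact convex disc \<open>cball 0 s\<close>, where the derivative is
  bounded and the mean value inequality applies.\<close>

lemma dilation_Lipschitz:
  assumes "f holomorphic_on ball 0 1" "0 < s" "s < 1"
  obtains L where "L \<ge> 0"
    "\<And>w z. w \<in> cball 0 1 \<Longrightarrow> z \<in> cball 0 1 \<Longrightarrow>
       norm (f (of_real s * w) - f (of_real s * z)) \<le> L * norm (w - z)"
proof -
  have "compact (deriv f ` cball 0 s)"
    using assms
    by (intro compact_continuous_image holomorphic_on_imp_continuous_on
          holomorphic_on_subset[OF holomorphic_deriv[of f "ball 0 1"]]) auto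
  then obtain L where L: "\<And>z. z \<in> cball 0 s \<Longrightarrow> norm (deriv f z) \<le> L"
    using compact_imp_bounded by (fastforce simp: bounded_iff)
  have "L \<ge> 0"
    using order_trans[OF norm_ge_zero L[of 0]] assms(2) by simp
  show ?thesis
  proof (rule that[OF \<open>L \<ge> 0\<close>])
    fix w z :: complex assume wz: "w \<in> cball 0 1" "z \<in> cball 0 1"
    have in_s: "of_real s * w \<in> cball 0 s" if "w \<in> cball 0 1" for w :: complex
      using that assms(2) by (auto simp: norm_mult intro: mult_left_le)
    have "norm (f (of_real s * w) - f (of_real s * z)) \<le> L * norm (of_real s * w - of_real s * z)"
    proof (rule field_differentiable_bound[OF convex_cball _ L])
      fix x :: complex assume "x \<in> cball 0 s"
      then have "f field_differentiable at x"
        using assms by (intro holomorphic_on_imp_differentiable_at[of f "ball 0 1"]) auto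
      then show "(f has_field_derivative deriv f x) (at x within cball 0 s)"
        by (simp add: DERIV_deriv_iff_field_differentiable has_field_derivative_at_within)
    qed (use in_s wz in auto)
    also have "\<dots> = L * (s * norm (w - z))"
      using assms(2) by (simp add: norm_mult flip: right_diff_distrib)
    also have "\<dots> \<le> L * norm (w - z)"
      using assms \<open>L \<ge> 0\<close> by (intro mult_left_mono mult_left_le_one_le) auto
    finally show "norm (f (of_real s * w) - f (of_real s * z)) \<le> L * norm (w - z)" .
  qed
qed

text \<open>The points \<open>z\<close> and \<open>of_real s * z\<close> are at most
  \<open>1 - s\<close> apart, so uniform continuity on the closed disc suffices once
  \<open>s\<close> is near 1.\<close>

lemma dilation_approx:
  fixes f :: "complex \<Rightarrow> complex"
  assumes "continuous_on (cball 0 1) f" "e > 0"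
  obtains s where "0 < s" "s < 1"
    "\<And>z. z \<in> cball 0 1 \<Longrightarrow> norm (f z - f (of_real s * z)) \<le> e"
proof -
  have "uniformly_continuous_on (cball 0 1) f"
    by (rule compact_uniformly_continuous[OF assms(1) compact_cball])
  then obtain d where d: "d > 0" "\<And>x y. x \<in> cball 0 1 \<Longrightarrow> y \<in> cball 0 1 \<Longrightarrow> dist x y < d \<Longrightarrow>
      dist (f x) (f y) < e"
    using assms(2) unfolding uniformly_continuous_on_def by metis
  \<comment> \<open>The minimum with 1 keeps \<open>s\<close> at least 1/2; halving makes
    \<open>1 - s\<close> strictly less than \<open>d\<close>.\<close>
  define s where "s = 1 - min d 1 / 2"
  have s: "0 < s" "s < 1" "1 - s < d"
    using d(1) by (auto simp: s_def min_def)
  have "norm (f z - f (of_real s * z)) \<le> e" if z: "z \<in> cball 0 1" for z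
  proof -
    have "of_real s * z \<in> cball 0 1"
      using z s by (auto simp: norm_mult intro: mult_le_one)
    moreover have "dist z (of_real s * z) < d"
    proof -
      have "z - of_real s * z = of_real (1 - s) * z"
        by (simp add: algebra_simps)
      then have "dist z (of_real s * z) = (1 - s) * norm z"
        using s by (simp only: dist_norm norm_mult norm_of_real)
      also have "\<dots> \<le> 1 - s"
        using s z by (intro mult_left_le) auto
      finally show ?thesis
        using s by simp
    qed
    ultimately show ?thesis
      using d(2)[OF z] by (auto simp: dist_norm less_imp_le)
  qed
  with s show ?thesis
    using that by blast
qed

lemma dense_not_Lipschitz_somewhere:
  assumes c: "c \<ge> 0"
  shows "disc.mtopology closure_of (mspace disc_algebra - Lipschitz_somewhere c) = mspace disc_algebra"
  unfolding disc.metric_closure_of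
proof (intro equalityI subsetI CollectI conjI strip)
  fix f and e :: real
  assume fM: "f \<in> mspace disc_algebra" and "e > 0"
  then have f: "continuous_on (cball 0 1) f" "f holomorphic_on ball 0 1"
    by (auto simp: mspace_disc_algebra)
  obtain s where s: "0 < s" "s < 1"
    and approx: "\<And>z. z \<in> cball 0 1 \<Longrightarrow> norm (f z - f (of_real s * z)) \<le> e / 3"
    using dilation_approx[OF f(1), of "e / 3"] \<open>e > 0\<close> by auto
  obtain L where L: "L \<ge> 0" "\<And>w z. w \<in> cball 0 1 \<Longrightarrow> z \<in> cball 0 1 \<Longrightarrow>
       norm (f (of_real s * w) - f (of_real s * z)) \<le> L * norm (w - z)"
    using dilation_Lipschitz[OF f(2) s] by blast
  \<comment> \<open>This says \<open>(c + L) * (pi / (2 * N)) < e / 3\<close>: a function with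
    constant \<open>c + L\<close> at a point cannot change by \<open>e / 3\<close> over a quarter
    period of \<open>cos (N * x)\<close>.\<close>
  obtain N :: nat where N: "(c + L) * (pi / 2) / (e / 3) < N"
    using reals_Archimedean2 by blast
  have "0 \<le> (c + L) * (pi / 2) / (e / 3)"
    using c L \<open>e > 0\<close> by simp
  with N have "N > 0"
    by (metis of_nat_0_less_iff le_less_trans)
  \<comment> \<open>The dilation and the monomial each cost at most \<open>e / 3\<close>, so the
    total change is at most \<open>2 * e / 3\<close>, below \<open>e\<close>.\<close>
  define p where "p z = f (of_real s * z) + of_real (e / 3) * z ^ N" for z
  define g where "g = restrict p (cball 0 1)"
  \<comment> \<open>Mapping the closed disc into the open one puts the dilation inside the domain of
    \<open>f\<close> for both holomorphy and continuity.\<close>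
  have sball: "(\<lambda>z. of_real s * z) ` cball 0 1 \<subseteq> ball (0::complex) 1"
  proof safe
    fix z :: complex assume "z \<in> cball 0 1"
    then have "s * norm z \<le> s"
      using s by (intro mult_left_le) auto
    then show "of_real s * z \<in> ball 0 1"
      using le_less_trans[OF _ s(2)] s(1) by (simp add: norm_mult)
  qed
  have "(\<lambda>z. of_real s * z) ` ball 0 1 \<subseteq> ball (0::complex) 1"
    using sball image_mono[OF ball_subset_cball] by (rule order_trans[rotated])
  then have "f \<circ> (\<lambda>z. of_real s * z) holomorphic_on ball 0 1"
    by (intro holomorphic_on_compose_gen[OF _ f(2)] holomorphic_on_mult
          holomorphic_on_const holomorphic_on_ident)
  then have "p holomorphic_on ball 0 1"
    unfolding p_def o_def
    by (intro holomorphic_on_add holomorphic_on_mult holomorphic_on_power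
          holomorphic_on_const holomorphic_on_ident)
  moreover have "continuous_on (cball 0 1) (\<lambda>z. f (of_real s * z))"
    by (rule continuous_on_compose2[OF f(1)], intro continuous_intros)
       (rule order_trans[OF sball ball_subset_cball])
  then have "continuous_on (cball 0 1) p"
    unfolding p_def by (intro continuous_intros)
  ultimately have gM: "g \<in> mspace disc_algebra"
    unfolding g_def by (intro restrict_in_disc_algebra)
  have "mdist disc_algebra f g \<le> 2 * e / 3"
  proof (rule mdist_disc_algebra_le[OF fM gM])
    fix z :: complex assume z: "z \<in> cball 0 1"
    have "norm (f z - g z) \<le> norm (f z - f (of_real s * z)) + norm (of_real (e / 3) * z ^ N)"
      using z norm_triangle_ineq4[of "f z - f (of_real s * z)" "of_real (e / 3) * z ^ N"]
      by (simp add: g_def p_def algebra_simps)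
    also have "norm (of_real (e / 3) * z ^ N) \<le> e / 3"
      unfolding norm_mult norm_power using z \<open>e > 0\<close>
      by (simp add: power_le_one)
    finally show "norm (f z - g z) \<le> 2 * e / 3"
      using approx[OF z] by simp
  qed
  moreover have "g \<notin> Lipschitz_somewhere c"
  proof
    assume "g \<in> Lipschitz_somewhere c"
    then obtain \<theta> where \<theta>: "\<And>t. \<bar>boundary_re g t - boundary_re g \<theta>\<bar> \<le> c * \<bar>t - \<theta>\<bar>"
      by (auto simp: Lipschitz_somewhere_def)
    obtain h where h: "\<bar>h\<bar> = pi / 2" "\<bar>cos (N * \<theta> + h) - cos (N * \<theta>)\<bar> \<ge> 1"
      by (rule cos_quarter_period_shift)
    \<comment> \<open>Dividing by \<open>N\<close> turns the quarter-period shift of the argument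
      \<open>N * \<theta>\<close> into a shift of \<open>\<theta>\<close> of size
      \<open>pi / (2 * N)\<close>.\<close>
    define t where "t = \<theta> + h / N"
    have t: "N * t = N * \<theta> + h" "\<bar>t - \<theta>\<bar> = pi / 2 / N"
      using \<open>N > 0\<close> h(1) by (auto simp: t_def field_simps)
    let ?q = "\<lambda>x. Re (f (of_real s * exp (\<i> * of_real x)))"
    have g_eq: "boundary_re g x = ?q x + e / 3 * cos (N * x)" for x :: real
      by (simp add: g_def p_def Re_exp mult_ac flip: exp_of_nat_mult)
    have "\<bar>?q t - ?q \<theta>\<bar> \<le> norm (f (of_real s * exp (\<i> * of_real t)) - f (of_real s * exp (\<i> * of_real \<theta>)))"
      by (metis abs_Re_le_cmod minus_complex.sel(1))
    also have "\<dots> \<le> L * norm (exp (\<i> * of_real t) - exp (\<i> * of_real \<theta>))"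
      by (intro L(2)) auto
    also have "\<dots> \<le> L * \<bar>t - \<theta>\<bar>"
      by (intro mult_left_mono norm_exp_i_diff_le L(1))
    finally have "\<bar>?q t - ?q \<theta>\<bar> \<le> L * \<bar>t - \<theta>\<bar>" .
    moreover have "e / 3 \<le> \<bar>e / 3 * cos (N * t) - e / 3 * cos (N * \<theta>)\<bar>"
      using mult_left_mono[OF h(2), of "e / 3"] \<open>e > 0\<close>
      unfolding t(1) right_diff_distrib[symmetric] abs_mult by simp
    \<comment> \<open>The oscillating term is \<open>boundary_re g\<close> minus the dilated part;
      their increments are bounded with constants \<open>c\<close> and \<open>L\<close>, which add
      up. The choice of \<open>N\<close> contradicts this.\<close>
    ultimately have "e / 3 \<le> (c + L) * \<bar>t - \<theta>\<bar>"
      using \<theta>[of t] unfolding g_eq distrib_right by linarith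
    then show False
      using N \<open>N > 0\<close> \<open>e > 0\<close> unfolding t(2) by (simp add: field_simps)
  qed
  ultimately show "\<exists>y\<in>mspace disc_algebra - Lipschitz_somewhere c. y \<in> disc.mball f e"
    using fM gM \<open>e > 0\<close> by (intro bexI[of _ g]) auto
qed (blast+)

section \<open>Conclusion by Baire's theorem\<close>

theorem theorem1p2:
  shows "residual_in (mtopology_of disc_algebra)
    {f \<in> mspace disc_algebra.
       \<forall>\<theta>::real. \<not> (\<lambda>t::real. Re (f (exp (\<i> * of_real t)))) differentiable (at \<theta>)}"
proof -
  \<comment> \<open>Natural constants keep the intersection countable, as both Baire's theorem and
    the G-delta property require.\<close>
  define U where "U n = mspace disc_algebra - Lipschitz_somewhere (real n)" for n :: nat
  have op: "openin disc.mtopology (U n)" for n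
    unfolding U_def using closedin_Lipschitz_somewhere by (simp add: openin_diff)
  have "disc.mtopology closure_of \<Inter>(range U) = mspace disc_algebra"
    using op by (intro disc.metric_Baire_category mcomplete_disc_algebra)
                (auto simp: U_def dense_not_Lipschitz_somewhere)
  moreover have "gdelta_in disc.mtopology (\<Inter>(range U))"
    using op by (intro gdelta_in_Inter) (auto intro: open_imp_gdelta_in)
  moreover have "\<Inter>(range U) \<subseteq> {f \<in> mspace disc_algebra.
       \<forall>\<theta>. \<not> boundary_re f differentiable (at \<theta>)}"
  proof safe
    fix f \<theta> assume f: "f \<in> \<Inter>(range U)"
    then show fM: "f \<in> mspace disc_algebra"
      by (auto simp: U_def)
    assume diff: "boundary_re f differentiable (at \<theta>)"
    obtain B where "\<And>t. \<bar>boundary_re f t\<bar> \<le> B"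
      using bounded_boundary_re[OF fM] by blast
    then obtain C where C: "\<And>t. \<bar>boundary_re f t - boundary_re f \<theta>\<bar> \<le> C * \<bar>t - \<theta>\<bar>"
      using differentiable_bounded_imp_Lipschitz_at[OF diff] by blast
    \<comment> \<open>Rounding the constant up weakens the estimate and places \<open>f\<close> in
      one of the countably many excluded sets.\<close>
    obtain n :: nat where "C \<le> n"
      using real_arch_simple by blast
    then have "\<bar>boundary_re f t - boundary_re f \<theta>\<bar> \<le> n * \<bar>t - \<theta>\<bar>" for t
      using C[of t] mult_right_mono[of C n "\<bar>t - \<theta>\<bar>"] by linarith
    then have "f \<in> Lipschitz_somewhere n"
      using fM by (auto simp: Lipschitz_somewhere_def)
    then show False
      using f by (auto simp: U_def)
  qed
  ultimately show ?thesis
    unfolding residual_in_def mtopology_of_def by auto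
qed

end
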